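(* When restricted to propositional AD-models, the revision operator $\mathrm R$, together with the expansion operator $\mathrm E$, satisfies the following, for all propositional AD-models $M$ and all events $E,E_1,E_2\subseteq\mathscr X$: (BR1) $\mathrm R(M\vert E)\in\mathbf M_{AD}(V)\cup\{\langle\mathscr G;\mathscr G\rangle\}$; (BR2) $M_E\subseteq\mathrm R(M\vert E)$; (BR3) $\mathrm R(M\vert E)\subseteq\mathrm E(M\vert E)$; (BR4) if $M\cup M_E$ is $V$-consistent, then $\mathrm E(M\vert E)\subseteq\mathrm R(M\vert E)$; (BR5) if $M_E$ is $V$-consistent, then $\mathrm R(M\vert E)$ is $V$-consistent; (BR7) $\mathrm R(M\vert E_1\cap E_2)\subseteq\mathrm E(\mathrm R(M\vert E_1)\vert E_2)$; (BR8) if $\mathrm R(M\vert E_1)\cup M_{E_2}$ is $V$-consistent, then $\mathrm E(\mathrm R(M\vert E_1)\vert E_2)\subseteq\mathrm R(M\vert E_1\cap E_2)$.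
   Context: $\mathscr X$ is a non-empty set; $\mathscr G$ is the real linear space of all gambles, i.e. bounded maps $f:\mathscr X\to\mathbb R$; $\mathbb I_B$ is the indicator of $B\subseteq\mathscr X$. $\mathscr G_{\geq0}=\{f:\inf f\geq0\}$, $\mathscr G_{\gtrdot0}=\{f:\inf f>0\}$. For non-empty $B$, $\inf(f\vert B)=\inf\{f(x):x\in B\}$. For $A,B\subseteq\mathscr G$: $-A$, $A+B$, $A-B$ are elementwise (Minkowski); $\mathrm{posi}(B)$ is the set of all finite (non-empty) linear combinations of elements of $B$ with strictly positive coefficients; $\mathrm{sh}(B)=\{\lambda f:f\in B,\lambda>0\}$. A convex cone is a set closed under addition and multiplication by strictly positive reals. An assessment is a pair $A=\langle A_{\mathrm{acc}};A_{\mathrm{rej}}\rangle$ of subsets of $\mathscr G$; inclusion, union, intersection are componentwise; $A_{\mathrm{des}}=A_{\mathrm{acc}}\cap(-A_{\mathrm{rej}})$. A statement model is an assessment $M$ with $0\in M_{\mathrm{acc}}$, $0\notin M_{\mathrm{rej}}$, $M_{\mathrm{acc}}$ a convex cone, and $\mathrm{sh}(M_{\mathrm{rej}})-M_{\mathrm{acc}}\subseteq M_{\mathrm{rej}}$; an AD-model is a statement model with $M_{\mathrm{rej}}\subseteq-M_{\mathrm{acc}}$. The background is $V=\langle\mathscr G_{\geq0};-\mathscr G_{\gtrdot0}\rangle$, and $\mathbf M_{AD}(V)$ is the set of AD-models including $V$. $A$ is $V$-consistent if $\mathrm{posi}(A_{\mathrm{acc}}\cup V_{\mathrm{acc}})\cap(A_{\mathrm{rej}}\cup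 V_{\mathrm{rej}})=\emptyset$. Propositional models: a proper filter on $\mathscr X$ is a non-empty collection $\mathscr F$ of subsets of $\mathscr X$, closed under finite intersections and supersets, with $\emptyset\notin\mathscr F$. An AD-model is propositional if it equals $M_{\mathscr F}:=\langle\{f:\exists B\in\mathscr F,\inf(f\vert B)\geq0\};-\{f:\exists B\in\mathscr F,\inf(f\vert B)>0\}\rangle$ for some proper filter $\mathscr F$. For $E\subseteq\mathscr X$ and $W\subseteq\mathscr G$: $I_E:=\{f\in\mathscr G:\mathbb I_Ef=0\}$, $M_E:=\langle I_E;\emptyset\rangle$, $W\Vert E:=\{f\in\mathscr G:\mathbb I_Ef\in W\}$. Expansion: for $M\in\mathbf M_{AD}(V)$, $\mathrm E(M\vert E):=\langle M_{\mathrm{acc}}+I_E;-(M_{\mathrm{des}}+I_E)\rangle$ if $0\notin M_{\mathrm{des}}+I_E$, and $\langle\mathscr G;\mathscr G\rangle$ otherwise; also $\mathrm E(\langle\mathscr G;\mathscr G\rangle\vert E)=\langle\mathscr G;\mathscr G\rangle$. (This is the intersection of all statement models including $M\cup M_E$, or $\langle\mathscr G;\mathscr G\rangle$ if there are none.) Revision: for $M\in\mathbf M_{AD}(V)$, $$\mathrm R(M\vert E):=\begin{cases}\langle M_{\mathrm{acc}}\Vert E;-(M_{\mathrm{des}}\Vert E\cup(\mathscr G_{\gtrdot0}+M_{\mathrm{acc}}\Vert E))\rangle&\text{if }0\notin M_{\mathrm{acc}}\Vert E+\mathscr G_{\gtrdot0}\\ \langle\mathscr G_{\geq0}+I_E;-(\mathscr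 G_{\gtrdot0}+I_E)\rangle&\text{if }0\in M_{\mathrm{acc}}\Vert E+\mathscr G_{\gtrdot0}\text{ and }0\notin\mathscr G_{\gtrdot0}+I_E\\ \langle\mathscr G;\mathscr G\rangle&\text{if }0\in\mathscr G_{\gtrdot0}+I_E.\end{cases}$$ *)

theory Defs
  imports "HOL-Analysis.Analysis" "HOL-Library.Function_Algebras"
begin

text \<open>
  The possibility space is (the universe of) the type variable \<open>'x\<close>, which is non-empty as every
  HOL type is. Sums, negatives, zero and products of gambles are the pointwise ones of
  \<^theory>\<open>HOL-Library.Function_Algebras\<close>, and \<open>A + B\<close> on sets of gambles is the Minkowski sum of
  \<^theory>\<open>HOL-Library.Set_Algebras\<close>. Beware that \<open>A - B\<close> on sets is set difference and \<open>- A\<close> is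
  complement; the elementwise operations are written \<open>A + uminus ` B\<close> and \<open>uminus ` A\<close>.
\<close>

definition gambles :: "('x \<Rightarrow> real) set"
  where "gambles = {f. bounded (range f)}"

definition gambles_nonneg :: "('x \<Rightarrow> real) set"
  where "gambles_nonneg = {f \<in> gambles. 0 \<le> (INF x. f x)}"

definition gambles_pos :: "('x \<Rightarrow> real) set"
  where "gambles_pos = {f \<in> gambles. 0 < (INF x. f x)}"

definition posi :: "('x \<Rightarrow> real) set \<Rightarrow> ('x \<Rightarrow> real) set"
  where "posi B = {(\<lambda>x. \<Sum>i<n. c i * g i x) | (n :: nat) (c :: nat \<Rightarrow> real) g.
                     0 < n \<and> (\<forall>i<n. 0 < c i \<and> g i \<in> B)}"

definition sh :: "('x \<Rightarrow> real) set \<Rightarrow> ('x \<Rightarrow> real) set"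
  where "sh B = {(\<lambda>x. l * f x) | (l :: real) f. f \<in> B \<and> 0 < l}"

text \<open>
  The library's \<^const>\<open>convex_cone\<close> is a different notion: it requires closure under multiplication
  by zero as well.
\<close>

definition strict_cone :: "('x \<Rightarrow> real) set \<Rightarrow> bool"
  where "strict_cone C \<longleftrightarrow>
    (\<forall>f\<in>C. \<forall>g\<in>C. f + g \<in> C) \<and> (\<forall>f\<in>C. \<forall>l>0. (\<lambda>x. l * f x) \<in> C)"

text \<open>
  Inclusion and union of assessments are \<open>\<le>\<close> and \<^const>\<open>sup\<close> on pairs, which
  \<^theory>\<open>HOL-Library.Product_Order\<close> defines componentwise.
\<close>

type_synonym 'x assessment = "('x \<Rightarrow> real) set \<times> ('x \<Rightarrow> real) set"

abbreviation acc :: "'x assessment \<Rightarrow> ('x \<Rightarrow> real) set"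
  where "acc A \<equiv> fst A"

abbreviation rej :: "'x assessment \<Rightarrow> ('x \<Rightarrow> real) set"
  where "rej A \<equiv> snd A"

definition des :: "'x assessment \<Rightarrow> ('x \<Rightarrow> real) set"
  where "des A = acc A \<inter> uminus ` rej A"

definition assessment :: "'x assessment \<Rightarrow> bool"
  where "assessment A \<longleftrightarrow> acc A \<subseteq> gambles \<and> rej A \<subseteq> gambles"

definition statement_model :: "'x assessment \<Rightarrow> bool"
  where "statement_model M \<longleftrightarrow>
    assessment M \<and> 0 \<in> acc M \<and> 0 \<notin> rej M \<and> strict_cone (acc M) \<and>
    sh (rej M) + uminus ` acc M \<subseteq> rej M"

definition AD_model :: "'x assessment \<Rightarrow> bool"
  where "AD_model M \<longleftrightarrow> statement_model M \<and> rej M \<subseteq> uminus ` acc M"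

definition background :: "'x assessment"
  where "background = (gambles_nonneg, uminus ` gambles_pos)"

definition AD_models :: "'x assessment set"
  where "AD_models = {M. AD_model M \<and> background \<le> M}"

definition full_assessment :: "'x assessment"
  where "full_assessment = (gambles, gambles)"

definition consistent :: "'x assessment \<Rightarrow> bool"
  where "consistent A \<longleftrightarrow>
    posi (acc A \<union> acc background) \<inter> (rej A \<union> rej background) = {}"

text \<open>
  A proper filter on \<open>'x\<close> is a library filter other than \<^const>\<open>bot\<close>; its members are the sets \<open>B\<close>
  with \<open>eventually (\<lambda>x. x \<in> B) F\<close>. The following lemma relates this to collections of sets.
\<close>

lemma proper_filter_iff:
  "\<FF> \<noteq> {} \<and> (\<forall>A\<in>\<FF>. \<forall>B\<in>\<FF>. A \<inter> B \<in> \<FF>) \<and> (\<forall>A\<in>\<FF>. \<forall>B. A \<subseteq> B \<longrightarrow> B \<in> \<FF>) \<and> {} \<notin> \<FF>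
    \<longleftrightarrow> (\<exists>F. F \<noteq> bot \<and> \<FF> = {B. eventually (\<lambda>x. x \<in> B) F})"
  (is "?L \<longleftrightarrow> ?R")
proof
  assume L: ?L
  define F where "F = Abs_filter (\<lambda>P. Collect P \<in> \<FF>)"
  have "is_filter (\<lambda>P. Collect P \<in> \<FF>)"
  proof
    show "Collect (\<lambda>x. True) \<in> \<FF>"
      using L by (metis UNIV_def ex_in_conv subset_UNIV)
    show "Collect (\<lambda>x. P x \<and> Q x) \<in> \<FF>" if "Collect P \<in> \<FF>" "Collect Q \<in> \<FF>" for P Q
      using L that by (simp add: Collect_conj_eq)
    show "Collect Q \<in> \<FF>" if "\<forall>x. P x \<longrightarrow> Q x" "Collect P \<in> \<FF>" for P Q
      using L that by (meson Collect_mono)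
  qed
  then have ev: "eventually P F \<longleftrightarrow> Collect P \<in> \<FF>" for P
    unfolding F_def by (rule eventually_Abs_filter)
  have "F \<noteq> bot"
    using L ev[of "\<lambda>x. False"] by (auto simp: trivial_limit_def)
  moreover have "\<FF> = {B. eventually (\<lambda>x. x \<in> B) F}"
    by (simp add: ev)
  ultimately show ?R by blast
next
  assume ?R
  then obtain F where F: "F \<noteq> bot" and mem: "B \<in> \<FF> \<longleftrightarrow> eventually (\<lambda>x. x \<in> B) F" for B
    by blast
  have "UNIV \<in> \<FF>" by (simp add: mem)
  moreover have "A \<inter> B \<in> \<FF>" if "A \<in> \<FF>" "B \<in> \<FF>" for A B
    using that by (simp add: mem eventually_conj)
  moreover have "B \<in> \<FF>" if "A \<in> \<FF>" "A \<subseteq> B" for A B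
    using that unfolding mem by (meson eventually_mono subsetD)
  moreover have "{} \<notin> \<FF>"
    using F by (simp add: mem trivial_limit_def)
  ultimately show ?L by blast
qed

definition propositional_model :: "'x filter \<Rightarrow> 'x assessment"
  where "propositional_model F =
    ({f \<in> gambles. \<exists>B. eventually (\<lambda>x. x \<in> B) F \<and> 0 \<le> (INF x\<in>B. f x)},
     uminus ` {f \<in> gambles. \<exists>B. eventually (\<lambda>x. x \<in> B) F \<and> 0 < (INF x\<in>B. f x)})"

definition propositional :: "'x assessment \<Rightarrow> bool"
  where "propositional M \<longleftrightarrow> AD_model M \<and> (\<exists>F. F \<noteq> bot \<and> M = propositional_model F)"

definition called_off :: "'x set \<Rightarrow> ('x \<Rightarrow> real) set"
  where "called_off E = {f \<in> gambles. indicator E * f = 0}"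

definition event_assessment :: "'x set \<Rightarrow> 'x assessment"
  where "event_assessment E = (called_off E, {})"

definition conditioned :: "('x \<Rightarrow> real) set \<Rightarrow> 'x set \<Rightarrow> ('x \<Rightarrow> real) set"  (infixl \<open>\<parallel>\<close> 75)
  where "W \<parallel> E = {f \<in> gambles. indicator E * f \<in> W}"

text \<open>
  The two operators are total here; they are meaningful only on \<^const>\<open>AD_models\<close> and, for
  expansion, also on \<^const>\<open>full_assessment\<close>.
\<close>

definition expansion :: "'x assessment \<Rightarrow> 'x set \<Rightarrow> 'x assessment"
  where "expansion M E =
    (if M \<noteq> full_assessment \<and> 0 \<notin> des M + called_off E
     then (acc M + called_off E, uminus ` (des M + called_off E))
     else full_assessment)"

definition revision :: "'x assessment \<Rightarrow> 'x set \<Rightarrow> 'x assessment"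
  where "revision M E =
    (if 0 \<notin> acc M \<parallel> E + gambles_pos
     then (acc M \<parallel> E, uminus ` (des M \<parallel> E \<union> (gambles_pos + acc M \<parallel> E)))
     else if 0 \<notin> gambles_pos + called_off E
     then (gambles_nonneg + called_off E, uminus ` (gambles_pos + called_off E))
     else full_assessment)"

end

theory Submission
  imports Defs
begin

text \<open>
  A propositional model is determined by its filter, and every step of the calculus is a filter
  operation. Allowing the trivial filter \<^const>\<open>bot\<close>, whose model is the full assessment, expansion
  by \<open>E\<close> is \<open>F \<mapsto> inf F (principal E)\<close>, and revision by \<open>E\<close> does the same unless the result is
  \<^const>\<open>bot\<close>, in which case it returns \<open>principal E\<close>. As \<open>V\<close>-consistency means that the filter is not
  \<^const>\<open>bot\<close>, the postulates become inequalities between filters.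
\<close>

section \<open>Closure properties of gambles\<close>

lemma mem_gambles_iff: "f \<in> gambles \<longleftrightarrow> (\<exists>K. \<forall>x. \<bar>f x\<bar> \<le> K)"
  by (auto simp: gambles_def bounded_iff)

lemma gambles_bounded_by:
  assumes "g \<in> gambles" "\<And>x. \<bar>f x\<bar> \<le> \<bar>g x\<bar>"
  shows "f \<in> gambles"
  using assms unfolding mem_gambles_iff by (meson order_trans)

lemma gambles_const: "(\<lambda>x. c) \<in> gambles"
  by (auto simp: mem_gambles_iff)

lemma gambles_zero: "0 \<in> gambles"
  using gambles_const[of 0] by (simp add: zero_fun_def)

lemma gambles_add:
  assumes "f \<in> gambles" "g \<in> gambles"
  shows "f + g \<in> gambles"
proof -
  obtain K L where "\<forall>x. \<bar>f x\<bar> \<le> K" "\<forall>x. \<bar>g x\<bar> \<le> L"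
    using assms unfolding mem_gambles_iff by blast
  then have "\<bar>(f + g) x\<bar> \<le> K + L" for x
    unfolding plus_fun_apply by (intro order_trans[OF abs_triangle_ineq] add_mono) auto
  then show ?thesis unfolding mem_gambles_iff by blast
qed

lemma gambles_uminus: "- f \<in> gambles \<longleftrightarrow> f \<in> gambles"
  by (simp add: mem_gambles_iff)

lemma gambles_diff: "f \<in> gambles \<Longrightarrow> g \<in> gambles \<Longrightarrow> f - g \<in> gambles"
  using gambles_add[of f "- g"] by (simp add: gambles_uminus)

lemma gambles_scale:
  assumes "f \<in> gambles"
  shows "(\<lambda>x. c * f x) \<in> gambles"
proof -
  obtain K where "\<forall>x. \<bar>f x\<bar> \<le> K"
    using assms unfolding mem_gambles_iff by blast
  then have "\<forall>x. \<bar>c * f x\<bar> \<le> \<bar>c\<bar> * K"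
    by (simp add: abs_mult mult_left_mono)
  then show ?thesis unfolding mem_gambles_iff by blast
qed

lemma gambles_indicator: "f \<in> gambles \<Longrightarrow> indicator E * f \<in> gambles"
  by (rule gambles_bounded_by) (auto simp: indicator_def)

lemma gambles_bdd_below: "f \<in> gambles \<Longrightarrow> bdd_below (f ` B)"
  unfolding gambles_def by (metis bounded_imp_bdd_below bounded_subset image_mono mem_Collect_eq subset_UNIV)

lemma mem_uminus_image: "f \<in> uminus ` A \<longleftrightarrow> - f \<in> A" for f :: "'x \<Rightarrow> real"
  by (metis image_iff minus_minus)

lemma mem_called_off: "f \<in> called_off E \<longleftrightarrow> f \<in> gambles \<and> (\<forall>x\<in>E. f x = 0)"
  by (auto simp: called_off_def fun_eq_iff indicator_def)

section \<open>Models of filters, the trivial filter included\<close>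

definition ev_nonneg :: "'x filter \<Rightarrow> ('x \<Rightarrow> real) set"
  where "ev_nonneg F = {f \<in> gambles. eventually (\<lambda>x. 0 \<le> f x) F}"

text \<open>The uniform bound \<open>c\<close> stands in for a positive infimum over a member of the
  filter; this form avoids infima over the empty set, which is a member of
  \<open>bot\<close>.\<close>

definition ev_pos :: "'x filter \<Rightarrow> ('x \<Rightarrow> real) set"
  where "ev_pos F = {f \<in> gambles. \<exists>c>0. eventually (\<lambda>x. c \<le> f x) F}"

definition filter_model :: "'x filter \<Rightarrow> 'x assessment"
  where "filter_model F = (ev_nonneg F, uminus ` ev_pos F)"

text \<open>Gambles are bounded below, so an infimum over a member is an eventual bound. Conversely,
  the set where a bound holds is itself a member, non-empty because the filter is proper, and serves
  as \<open>B\<close>.\<close>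

lemma propositional_model_eq:
  assumes F: "F \<noteq> bot"
  shows "propositional_model F = filter_model F"
proof -
  have nonempty: "{x. P x} \<noteq> {}" if "eventually P F" for P
    using eventually_happens'[OF F that] by blast
  have "(\<exists>B. eventually (\<lambda>x. x \<in> B) F \<and> 0 \<le> (INF x\<in>B. f x)) \<longleftrightarrow> eventually (\<lambda>x. 0 \<le> f x) F"
    if f: "f \<in> gambles" for f
  proof
    assume "\<exists>B. eventually (\<lambda>x. x \<in> B) F \<and> 0 \<le> (INF x\<in>B. f x)"
    then obtain B where "eventually (\<lambda>x. x \<in> B) F" and B: "0 \<le> (INF x\<in>B. f x)"
      by blast
    then show "eventually (\<lambda>x. 0 \<le> f x) F"
      by (elim eventually_mono) (rule order_trans[OF B cINF_lower[OF gambles_bdd_below[OF f]]])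
  next
    assume ev: "eventually (\<lambda>x. 0 \<le> f x) F"
    have "0 \<le> (INF x\<in>{x. 0 \<le> f x}. f x)"
      by (rule cINF_greatest[OF nonempty[OF ev]]) simp
    with ev show "\<exists>B. eventually (\<lambda>x. x \<in> B) F \<and> 0 \<le> (INF x\<in>B. f x)"
      by (intro exI[of _ "{x. 0 \<le> f x}"]) simp
  qed
  moreover have "(\<exists>B. eventually (\<lambda>x. x \<in> B) F \<and> 0 < (INF x\<in>B. f x)) \<longleftrightarrow>
      (\<exists>c>0. eventually (\<lambda>x. c \<le> f x) F)" if f: "f \<in> gambles" for f
  proof
    assume "\<exists>B. eventually (\<lambda>x. x \<in> B) F \<and> 0 < (INF x\<in>B. f x)"
    then obtain B where B: "eventually (\<lambda>x. x \<in> B) F" "0 < (INF x\<in>B. f x)"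
      by blast
    have "eventually (\<lambda>x. (INF x\<in>B. f x) \<le> f x) F"
      using B(1) by (rule eventually_mono) (rule cINF_lower[OF gambles_bdd_below[OF f]])
    with B(2) show "\<exists>c>0. eventually (\<lambda>x. c \<le> f x) F" by blast
  next
    assume "\<exists>c>0. eventually (\<lambda>x. c \<le> f x) F"
    then obtain c where c: "0 < c" and ev: "eventually (\<lambda>x. c \<le> f x) F"
      by blast
    have "c \<le> (INF x\<in>{x. c \<le> f x}. f x)"
      by (rule cINF_greatest[OF nonempty[OF ev]]) simp
    with c ev show "\<exists>B. eventually (\<lambda>x. x \<in> B) F \<and> 0 < (INF x\<in>B. f x)"
      by (intro exI[of _ "{x. c \<le> f x}"]) simp
  qed
  ultimately show ?thesis
    unfolding propositional_model_def filter_model_def ev_nonneg_def ev_pos_def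
    by (simp cong: conj_cong)
qed

lemma gambles_nonneg_eq: "gambles_nonneg = (ev_nonneg top :: ('x \<Rightarrow> real) set)"
proof -
  have "0 \<le> (INF x. f x) \<longleftrightarrow> (\<forall>x. 0 \<le> f x)" if "f \<in> gambles" for f :: "'x \<Rightarrow> real"
    using le_cINF_iff[OF UNIV_not_empty gambles_bdd_below[OF that], of 0] by simp
  then show ?thesis
    by (auto simp: gambles_nonneg_def ev_nonneg_def)
qed

lemma gambles_pos_eq: "gambles_pos = (ev_pos top :: ('x \<Rightarrow> real) set)"
proof -
  have "0 < (INF x. f x) \<longleftrightarrow> (\<exists>c>0. \<forall>x. c \<le> f x)" if "f \<in> gambles" for f :: "'x \<Rightarrow> real"
    using le_cINF_iff[OF UNIV_not_empty gambles_bdd_below[OF that]]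
    by (metis UNIV_I order_less_le_trans order_refl)
  then show ?thesis
    by (auto simp: gambles_pos_def ev_pos_def)
qed

text \<open>Along \<open>top\<close>, \<open>eventually\<close> means everywhere, so the background
  is the vacuous model, included in every other filter model by antitonicity.\<close>

lemma background_eq: "background = filter_model top"
  by (simp add: background_def filter_model_def gambles_nonneg_eq gambles_pos_eq)

lemma ev_nonneg_bot: "ev_nonneg bot = gambles"
  by (simp add: ev_nonneg_def)

lemma ev_pos_bot: "ev_pos bot = gambles"
  using gt_ex[of "0 :: real"] by (auto simp: ev_pos_def)

lemma filter_model_bot: "filter_model bot = full_assessment"
  by (auto simp: filter_model_def full_assessment_def ev_nonneg_bot ev_pos_bot
      mem_uminus_image gambles_uminus)

text \<open>A positive \<open>c\<close> with \<open>c \<le> 0\<close> eventually makes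
  \<open>False\<close> hold eventually. This turns the case tests of \<open>expansion\<close> and
  \<open>revision\<close> into tests for \<open>bot\<close>.\<close>

lemma zero_in_ev_pos_iff: "0 \<in> ev_pos F \<longleftrightarrow> F = bot"
proof
  assume "0 \<in> ev_pos F"
  then show "F = bot"
    by (auto simp: ev_pos_def trivial_limit_def elim!: eventually_mono)
qed (simp add: ev_pos_bot gambles_zero)

lemma minus_one_in_ev_nonneg_iff: "(\<lambda>x. - 1) \<in> ev_nonneg F \<longleftrightarrow> F = bot"
  by (simp add: ev_nonneg_def gambles_const trivial_limit_def)

text \<open>The constant gamble -1 separates the models: only the trivial filter accepts it.\<close>

lemma filter_model_eq_full_iff: "filter_model F = full_assessment \<longleftrightarrow> F = bot"
  by (metis filter_model_bot filter_model_def fst_conv minus_one_in_ev_nonneg_iff)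

lemma ev_pos_subset: "ev_pos F \<subseteq> ev_nonneg F"
  unfolding ev_pos_def ev_nonneg_def by (auto elim!: eventually_mono)

lemma ev_nonneg_antimono: "F \<le> G \<Longrightarrow> ev_nonneg G \<subseteq> ev_nonneg F"
  unfolding ev_nonneg_def by (auto dest: filter_leD)

lemma ev_pos_antimono: "F \<le> G \<Longrightarrow> ev_pos G \<subseteq> ev_pos F"
  unfolding ev_pos_def by (auto dest: filter_leD)

lemma filter_model_antimono: "F \<le> G \<Longrightarrow> filter_model G \<le> filter_model F"
  by (simp add: filter_model_def less_eq_prod_def ev_nonneg_antimono ev_pos_antimono image_mono)

section \<open>Sums and positive multiples\<close>

lemma ev_pos_add_ev_nonneg:
  assumes "f \<in> ev_pos F" "g \<in> ev_nonneg F"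
  shows "f + g \<in> ev_pos F"
proof -
  obtain c where c: "0 < c" "eventually (\<lambda>x. c \<le> f x) F"
    using assms(1) by (auto simp: ev_pos_def)
  have "eventually (\<lambda>x. 0 \<le> g x) F"
    using assms(2) by (simp add: ev_nonneg_def)
  with c(2) have "eventually (\<lambda>x. c \<le> (f + g) x) F"
    by eventually_elim simp
  with c(1) show ?thesis
    using assms by (auto simp: ev_pos_def ev_nonneg_def gambles_add)
qed

lemma ev_nonneg_add: "f \<in> ev_nonneg F \<Longrightarrow> g \<in> ev_nonneg F \<Longrightarrow> f + g \<in> ev_nonneg F"
  unfolding ev_nonneg_def by (auto simp: gambles_add elim: eventually_elim2)

lemma ev_nonneg_scale: "f \<in> ev_nonneg F \<Longrightarrow> 0 < c \<Longrightarrow> (\<lambda>x. c * f x) \<in> ev_nonneg F"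
  unfolding ev_nonneg_def by (auto simp: gambles_scale elim!: eventually_mono)

lemma ev_pos_scale:
  assumes "f \<in> ev_pos F" "0 < c"
  shows "(\<lambda>x. c * f x) \<in> ev_pos F"
proof -
  obtain d where "0 < d" "eventually (\<lambda>x. d \<le> f x) F"
    using assms(1) by (auto simp: ev_pos_def)
  then have "0 < c * d" "eventually (\<lambda>x. c * d \<le> c * f x) F"
    using assms(2) by (auto elim!: eventually_mono)
  then show ?thesis
    using assms(1) by (auto simp: ev_pos_def gambles_scale)
qed

text \<open>From right to left, an eventual bound \<open>c\<close> is split off as a constant
  gamble, leaving an eventually nonnegative remainder.\<close>

lemma gambles_pos_plus_ev_nonneg: "gambles_pos + ev_nonneg F = ev_pos F"
proof
  show "gambles_pos + ev_nonneg F \<subseteq> ev_pos F"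
    using ev_pos_add_ev_nonneg ev_pos_antimono[OF top_greatest]
    by (fastforce simp: gambles_pos_eq elim!: set_plus_elim)
  show "ev_pos F \<subseteq> gambles_pos + ev_nonneg F"
  proof
    fix f assume f: "f \<in> ev_pos F"
    then obtain c where c: "0 < c" "eventually (\<lambda>x. c \<le> f x) F"
      by (auto simp: ev_pos_def)
    have "(\<lambda>x. c) \<in> gambles_pos"
      using c(1) by (auto simp: gambles_pos_eq ev_pos_def gambles_const)
    moreover have "f - (\<lambda>x. c) \<in> ev_nonneg F"
      using f c(2) by (auto simp: ev_nonneg_def ev_pos_def gambles_const gambles_diff)
    ultimately have "(\<lambda>x. c) + (f - (\<lambda>x. c)) \<in> gambles_pos + ev_nonneg F"
      by (rule set_plus_intro)
    then show "f \<in> gambles_pos + ev_nonneg F" by simp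
  qed
qed

section \<open>Expansion and revision as filter operations\<close>

text \<open>Splits off a called-off remainder; the value \<open>c\<close> outside \<open>E\<close>
  is free, to be chosen so that the main part satisfies the inequality wanted there.\<close>

lemma override_gamble:
  assumes "f \<in> gambles"
  shows "(\<lambda>x. if x \<in> E then f x else c) \<in> gambles"
    and "f - (\<lambda>x. if x \<in> E then f x else c) \<in> called_off E"
proof -
  obtain K where K: "\<forall>x. \<bar>f x\<bar> \<le> K"
    using assms unfolding mem_gambles_iff by blast
  show "(\<lambda>x. if x \<in> E then f x else c) \<in> gambles"
    unfolding mem_gambles_iff
    by (rule exI[of _ "max K \<bar>c\<bar>"]) (use K in \<open>auto intro: le_max_iff_disj[THEN iffD2]\<close>)
  then show "f - (\<lambda>x. if x \<in> E then f x else c) \<in> called_off E"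
    using assms by (simp add: mem_called_off gambles_diff)
qed

text \<open>Adding a called-off gamble changes nothing on \<open>E\<close>, and
  \<open>inf F (principal E)\<close> only looks at values on \<open>E\<close>.\<close>

lemma ev_nonneg_plus_called_off: "ev_nonneg F + called_off E = ev_nonneg (inf F (principal E))"
proof
  show "ev_nonneg F + called_off E \<subseteq> ev_nonneg (inf F (principal E))"
    by (auto simp: ev_nonneg_def mem_called_off eventually_inf_principal gambles_add
        elim!: set_plus_elim eventually_mono)
  show "ev_nonneg (inf F (principal E)) \<subseteq> ev_nonneg F + called_off E"
  proof
    fix f assume f: "f \<in> ev_nonneg (inf F (principal E))"
    let ?g = "\<lambda>x. if x \<in> E then f x else 0"
    have "eventually (\<lambda>x. 0 \<le> ?g x) F"
      using f by (auto simp: ev_nonneg_def eventually_inf_principal elim!: eventually_mono)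
    then have "?g \<in> ev_nonneg F" "f - ?g \<in> called_off E"
      using f override_gamble[of f E 0] by (auto simp: ev_nonneg_def)
    then have "?g + (f - ?g) \<in> ev_nonneg F + called_off E"
      by (rule set_plus_intro)
    then show "f \<in> ev_nonneg F + called_off E" by simp
  qed
qed

lemma ev_pos_plus_called_off: "ev_pos F + called_off E = ev_pos (inf F (principal E))"
proof
  show "ev_pos F + called_off E \<subseteq> ev_pos (inf F (principal E))"
  proof
    fix h assume "h \<in> ev_pos F + called_off E"
    then obtain f g where h: "h = f + g" and f: "f \<in> ev_pos F" and g: "g \<in> called_off E"
      by (rule set_plus_elim)
    from f obtain c where c: "0 < c" "eventually (\<lambda>x. c \<le> f x) F"
      by (auto simp: ev_pos_def)
    then have "eventually (\<lambda>x. c \<le> h x) (inf F (principal E))"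
      using g by (auto simp: h mem_called_off eventually_inf_principal elim!: eventually_mono)
    with c(1) show "h \<in> ev_pos (inf F (principal E))"
      using f g by (auto simp: h ev_pos_def mem_called_off gambles_add)
  qed
  show "ev_pos (inf F (principal E)) \<subseteq> ev_pos F + called_off E"
  proof
    fix f assume f: "f \<in> ev_pos (inf F (principal E))"
    then obtain c where c: "0 < c" "eventually (\<lambda>x. x \<in> E \<longrightarrow> c \<le> f x) F"
      by (auto simp: ev_pos_def eventually_inf_principal)
    \<comment> \<open>Outside \<open>E\<close> the value is \<open>c\<close> and not 0, so that the
      uniform positive bound holds there as well.\<close>
    let ?g = "\<lambda>x. if x \<in> E then f x else c"
    have "eventually (\<lambda>x. c \<le> ?g x) F"
      using c(2) by (auto elim!: eventually_mono)
    with f c(1) have "?g \<in> ev_pos F" "f - ?g \<in> called_off E"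
      using override_gamble[of f E c] unfolding ev_pos_def by blast+
    then have "?g + (f - ?g) \<in> ev_pos F + called_off E"
      by (rule set_plus_intro)
    then show "f \<in> ev_pos F + called_off E" by simp
  qed
qed

text \<open>Outside \<open>E\<close> the product with the indicator is 0, which satisfies the weak
  inequality; hence conditioning accepts the same gambles as adding
  \<open>called_off E\<close>.\<close>

lemma ev_nonneg_conditioned:
  fixes E :: "'x set"
  shows "ev_nonneg F \<parallel> E = ev_nonneg (inf F (principal E))"
proof -
  have "0 \<le> (indicator E * f) x \<longleftrightarrow> (x \<in> E \<longrightarrow> 0 \<le> f x)" for f :: "'x \<Rightarrow> real" and x
    by (simp add: indicator_def)
  then show ?thesis
    unfolding conditioned_def ev_nonneg_def eventually_inf_principal
    by (auto simp: gambles_indicator simp del: times_fun_apply)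
qed

text \<open>Only an inclusion: \<open>indicator E * f\<close> is 0 outside \<open>E\<close>, so a
  positive bound for it forces \<open>E\<close> itself to hold eventually along
  \<open>F\<close>.\<close>

lemma ev_pos_conditioned_subset: "ev_pos F \<parallel> E \<subseteq> ev_pos (inf F (principal E))"
  unfolding conditioned_def ev_pos_def eventually_inf_principal
  by (fastforce simp: indicator_def elim: eventually_mono)

lemma des_filter_model: "des (filter_model F) = ev_pos F"
  using ev_pos_subset[of F] by (auto simp: des_def filter_model_def image_image)

lemma expansion_filter_model:
  "expansion (filter_model F) E = filter_model (inf F (principal E))"
proof (cases "inf F (principal E) = bot")
  case True
  then show ?thesis
    by (simp add: expansion_def des_filter_model ev_pos_plus_called_off zero_in_ev_pos_iff
        filter_model_bot)
next
  case False
  \<comment> \<open>Thus the model is not the full assessment, and both tests of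
    \<open>expansion\<close> succeed.\<close>
  then have "F \<noteq> bot" by auto
  with False show ?thesis
    by (simp add: expansion_def des_filter_model ev_pos_plus_called_off zero_in_ev_pos_iff
        filter_model_eq_full_iff)
       (simp add: filter_model_def ev_nonneg_plus_called_off)
qed

text \<open>The fallback \<open>principal E\<close> belongs to the background expanded by
  \<open>E\<close>. It is \<open>bot\<close> exactly when \<open>E\<close> is empty, which accounts
  for the third case of \<open>revision\<close>.\<close>

definition revise :: "'x filter \<Rightarrow> 'x set \<Rightarrow> 'x filter"
  where "revise F E = (if inf F (principal E) \<noteq> bot then inf F (principal E) else principal E)"

text \<open>Every set in \<open>revision\<close> becomes \<open>ev_nonneg\<close> or
  \<open>ev_pos\<close> of \<open>inf F (principal E)\<close> or of \<open>principal E\<close>;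
  membership of 0 then tells whether that filter is \<open>bot\<close>.\<close>

lemma revision_filter_model: "revision (filter_model F) E = filter_model (revise F E)"
proof -
  have acc: "acc (filter_model F) \<parallel> E = ev_nonneg (inf F (principal E))"
    by (simp add: filter_model_def ev_nonneg_conditioned)
  have des: "des (filter_model F) \<parallel> E \<union> ev_pos (inf F (principal E)) = ev_pos (inf F (principal E))"
    using ev_pos_conditioned_subset by (auto simp: des_filter_model)
  have "acc (filter_model F) \<parallel> E + gambles_pos = ev_pos (inf F (principal E))"
    by (simp add: acc add.commute[of _ gambles_pos] gambles_pos_plus_ev_nonneg)
  moreover have "gambles_nonneg + called_off E = ev_nonneg (principal E)"
    by (simp add: gambles_nonneg_eq ev_nonneg_plus_called_off)
  moreover have "gambles_pos + called_off E = ev_pos (principal E)"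
    by (simp add: gambles_pos_eq ev_pos_plus_called_off)
  ultimately show ?thesis
    unfolding revision_def revise_def
    by (auto simp: acc des gambles_pos_plus_ev_nonneg zero_in_ev_pos_iff filter_model_bot
        simp flip: filter_model_def)
qed

section \<open>AD-models and consistency\<close>

lemma filter_model_AD:
  assumes F: "F \<noteq> bot"
  shows "filter_model F \<in> AD_models"
proof -
  have "assessment (filter_model F)"
    by (auto simp: assessment_def filter_model_def ev_nonneg_def ev_pos_def gambles_uminus)
  moreover have "0 \<in> ev_nonneg F"
    by (simp add: ev_nonneg_def gambles_zero)
  moreover have "0 \<notin> uminus ` ev_pos F"
    using F by (simp add: mem_uminus_image zero_in_ev_pos_iff)
  moreover have "strict_cone (ev_nonneg F)"
    by (auto simp: strict_cone_def ev_nonneg_add ev_nonneg_scale)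
  \<comment> \<open>After negation, this says that \<open>ev_pos F\<close> is stable under positive
    scaling and absorbs \<open>ev_nonneg F\<close>.\<close>
  moreover have "sh (uminus ` ev_pos F) + uminus ` ev_nonneg F \<subseteq> uminus ` ev_pos F"
  proof
    fix h assume "h \<in> sh (uminus ` ev_pos F) + uminus ` ev_nonneg F"
    then obtain l f g where l: "0 < l" and f: "f \<in> ev_pos F" and g: "g \<in> ev_nonneg F"
      and h: "h = (\<lambda>x. l * (- f) x) + - g"
      by (auto simp: sh_def elim!: set_plus_elim)
    have "- h = (\<lambda>x. l * f x) + g"
      by (simp add: h fun_eq_iff)
    then show "h \<in> uminus ` ev_pos F"
      using ev_pos_add_ev_nonneg[OF ev_pos_scale[OF f l] g] by (simp add: mem_uminus_image)
  qed
  moreover have "uminus ` ev_pos F \<subseteq> uminus ` ev_nonneg F"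
    by (rule image_mono[OF ev_pos_subset])
  ultimately have "AD_model (filter_model F)"
    by (simp add: AD_model_def statement_model_def filter_model_def)
  then show ?thesis
    by (simp add: AD_models_def background_eq filter_model_antimono)
qed

lemma posi_add:
  assumes "f \<in> B" "g \<in> B"
  shows "f + g \<in> posi B"
  unfolding posi_def mem_Collect_eq
  by (rule exI[of _ 2], rule exI[of _ "\<lambda>_. 1"], rule exI[of _ "\<lambda>i. if i = 0 then f else g"])
     (use assms in \<open>auto simp: numeral_2_eq_2 fun_eq_iff\<close>)

lemma posi_ev_nonneg: "posi (ev_nonneg F) \<subseteq> ev_nonneg F"
proof
  fix f assume "f \<in> posi (ev_nonneg F)"
  then obtain n :: nat and c g where
    f: "f = (\<lambda>x. \<Sum>i<n. c i * g i x)" and cg: "\<forall>i<n. 0 < c i \<and> g i \<in> ev_nonneg F"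
    unfolding posi_def by blast
  from cg have "(\<lambda>x. \<Sum>i<n. c i * g i x) \<in> ev_nonneg F"
  proof (induction n)
    \<comment> \<open>The induction may start at the empty sum, although \<open>posi\<close> asks
      for a summand, because 0 is eventually nonnegative.\<close>
    case 0
    show ?case by (simp add: ev_nonneg_def gambles_const)
  next
    case (Suc n)
    then have "(\<lambda>x. \<Sum>i<n. c i * g i x) + (\<lambda>x. c n * g n x) \<in> ev_nonneg F"
      by (intro ev_nonneg_add ev_nonneg_scale) auto
    then show ?case by (simp add: plus_fun_def)
  qed
  then show "f \<in> ev_nonneg F" by (simp add: f)
qed

lemma consistent_filter_model:
  assumes F: "F \<noteq> bot"
  shows "consistent (filter_model F)"
proof -
  have "acc (filter_model F) \<union> acc background = ev_nonneg F"
    using ev_nonneg_antimono[of F top] by (auto simp: background_eq filter_model_def)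
  moreover have "rej (filter_model F) \<union> rej background = uminus ` ev_pos F"
    using ev_pos_antimono[of F top] by (auto simp: background_eq filter_model_def)
  \<comment> \<open>The two gambles sum to 0, which lies in \<open>ev_pos F\<close> only for the
    trivial filter.\<close>
  moreover have False if "- f \<in> posi (ev_nonneg F)" "f \<in> ev_pos F" for f
    using ev_pos_add_ev_nonneg[OF that(2), of "- f"] that(1) posi_ev_nonneg F
    by (auto simp: zero_in_ev_pos_iff)
  ultimately show ?thesis
    by (auto simp: consistent_def mem_uminus_image)
qed

text \<open>The background rejects the constant -1, so inconsistency can be shown by building -1
  from accepted gambles.\<close>

lemma consistent_minus_one: "consistent A \<Longrightarrow> (\<lambda>x. - 1) \<notin> posi (acc A \<union> acc background)"
  unfolding consistent_def
  by (force simp: background_eq filter_model_def mem_uminus_image ev_pos_def gambles_const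
      gambles_uminus intro: zero_less_one)

lemma event_consistent_imp_nonempty:
  assumes "consistent (event_assessment E)"
  shows "E \<noteq> {}"
proof
  assume "E = {}"
  \<comment> \<open>The empty event calls off every gamble; halves are taken because
    \<open>posi_add\<close> yields a sum of two members.\<close>
  then have "(\<lambda>x. - (1/2)) \<in> called_off E"
    by (simp add: mem_called_off gambles_const)
  then have "(\<lambda>x. - (1/2)) + (\<lambda>x. - (1/2)) \<in> posi (called_off E \<union> acc background)"
    by (intro posi_add) auto
  with consistent_minus_one[OF assms] show False
    by (simp add: event_assessment_def plus_fun_def)
qed

text \<open>If \<open>E\<close> eventually fails along \<open>F\<close>, the constant -1 splits into
  a part on \<open>E\<close>, eventually 0 and hence accepted, and a part outside \<open>E\<close>,
  which is called off.\<close>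

lemma consistent_imp_inf_principal:
  assumes "consistent (sup (filter_model F) (event_assessment E))"
  shows "inf F (principal E) \<noteq> bot"
proof
  assume "inf F (principal E) = bot"
  then have "eventually (\<lambda>x. x \<notin> E) F"
    by (simp add: trivial_limit_def eventually_inf_principal)
  then have "(\<lambda>x. if x \<in> E then - 1 else 0) \<in> ev_nonneg F"
    using override_gamble(1)[OF gambles_const, of E "- 1" 0]
    by (auto simp: ev_nonneg_def elim!: eventually_mono)
  moreover have "(\<lambda>x. if x \<in> E then 0 else - 1) \<in> called_off E"
    using override_gamble(1)[OF gambles_const, of E 0 "- 1"] by (simp add: mem_called_off)
  ultimately have "(\<lambda>x. if x \<in> E then - 1 else 0) + (\<lambda>x. if x \<in> E then 0 else - 1)
      \<in> posi (acc (sup (filter_model F) (event_assessment E)) \<union> acc background)"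
    by (intro posi_add) (auto simp: filter_model_def event_assessment_def)
  moreover have "(\<lambda>x. if x \<in> E then - 1 else 0) + (\<lambda>x. if x \<in> E then 0 else - 1) = (\<lambda>x. - 1 :: real)"
    by (simp add: fun_eq_iff)
  ultimately show False
    using consistent_minus_one[OF assms] by simp
qed

section \<open>The postulates\<close>

lemma event_assessment_le:
  assumes "F \<le> principal E"
  shows "event_assessment E \<le> filter_model F"
proof -
  have "called_off E \<subseteq> ev_nonneg (principal E)"
    by (auto simp: mem_called_off ev_nonneg_def eventually_principal)
  also have "\<dots> \<subseteq> ev_nonneg F"
    by (rule ev_nonneg_antimono[OF assms])
  finally show ?thesis
    by (simp add: event_assessment_def filter_model_def less_eq_prod_def)
qed

text \<open>If \<open>F\<close> is compatible with \<open>E\<^sub>1\<close>, both sides are the meet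
  of \<open>F\<close> with \<open>E\<^sub>1 \<inter> E\<^sub>2\<close>, by associativity. Otherwise
  \<open>F\<close> is incompatible with the smaller event too, and both sides are
  \<open>principal (E\<^sub>1 \<inter> E\<^sub>2)\<close>.\<close>

lemma revise_inf:
  "inf (revise F E\<^sub>1) (principal E\<^sub>2) \<noteq> bot \<Longrightarrow>
    revise F (E\<^sub>1 \<inter> E\<^sub>2) = inf (revise F E\<^sub>1) (principal E\<^sub>2)"
  by (cases "inf F (principal E\<^sub>1) = bot")
     (auto simp: revise_def simp flip: inf_principal inf_assoc)

theorem proposition15:
  fixes M :: "'x assessment" and E E\<^sub>1 E\<^sub>2 :: "'x set"
  assumes "propositional M"
  shows "revision M E \<in> AD_models \<union> {full_assessment} \<and>
    event_assessment E \<le> revision M E \<and>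
    revision M E \<le> expansion M E \<and>
    (consistent (sup M (event_assessment E)) \<longrightarrow> expansion M E \<le> revision M E) \<and>
    (consistent (event_assessment E) \<longrightarrow> consistent (revision M E)) \<and>
    revision M (E\<^sub>1 \<inter> E\<^sub>2) \<le> expansion (revision M E\<^sub>1) E\<^sub>2 \<and>
    (consistent (sup (revision M E\<^sub>1) (event_assessment E\<^sub>2)) \<longrightarrow>
      expansion (revision M E\<^sub>1) E\<^sub>2 \<le> revision M (E\<^sub>1 \<inter> E\<^sub>2))"
proof -
  from assms obtain F where M: "M = filter_model F"
    by (auto simp: propositional_def propositional_model_eq)
  have 1: "filter_model (revise F E) \<in> AD_models \<union> {full_assessment}"
    using filter_model_AD filter_model_bot by (cases "revise F E = bot") auto
  have 2: "event_assessment E \<le> filter_model (revise F E)"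
    by (rule event_assessment_le) (simp add: revise_def)
  \<comment> \<open>Either the filters agree or the meet is \<open>bot\<close>, the least filter;
    passing to models reverses the order.\<close>
  have 3: "filter_model (revise F E) \<le> filter_model (inf F (principal E))"
    by (rule filter_model_antimono) (simp add: revise_def)
  have 4: "filter_model (inf F (principal E)) \<le> filter_model (revise F E)"
    if "consistent (sup (filter_model F) (event_assessment E))"
    using consistent_imp_inf_principal[OF that] by (simp add: revise_def)
  \<comment> \<open>For a non-empty event both branches of \<open>revise\<close> give a proper
    filter.\<close>
  have 5: "consistent (filter_model (revise F E))" if "consistent (event_assessment E)"
    using event_consistent_imp_nonempty[OF that]
    by (intro consistent_filter_model) (simp add: revise_def principal_eq_bot_iff)
  \<comment> \<open>The meet is either \<open>bot\<close>, hence least, or equal to the other filter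
    by \<open>revise_inf\<close>; consistency in the next claim excludes the first case.\<close>
  have 7: "filter_model (revise F (E\<^sub>1 \<inter> E\<^sub>2)) \<le> filter_model (inf (revise F E\<^sub>1) (principal E\<^sub>2))"
    by (rule filter_model_antimono) (metis bot_least order_refl revise_inf)
  have 8: "filter_model (inf (revise F E\<^sub>1) (principal E\<^sub>2)) \<le> filter_model (revise F (E\<^sub>1 \<inter> E\<^sub>2))"
    if "consistent (sup (filter_model (revise F E\<^sub>1)) (event_assessment E\<^sub>2))"
    using revise_inf[OF consistent_imp_inf_principal[OF that]] by simp
  show ?thesis
    unfolding M revision_filter_model expansion_filter_model
    using 1 2 3 4 5 7 8 by blast
qed

end
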